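(* Every Pisot number $q \in (1,2)$ of degree at most $150$ satisfies $|q'| \geq \frac{\sqrt5-1}{2}$ for all Galois conjugates $q'$ of $q$.
   Context: A Pisot number is a real algebraic integer $q>1$ all of whose other Galois conjugates have absolute value strictly less than $1$. *)

theory Defs
  imports "HOL-Computational_Algebra.Computational_Algebra" Complex_Main
begin

definition is_min_poly :: "rat poly \<Rightarrow> complex \<Rightarrow> bool" where
  "is_min_poly p x \<longleftrightarrow> lead_coeff p = 1 \<and> irreducible p \<and> poly (map_poly of_rat p) x = 0"

definition galois_conjugates :: "complex \<Rightarrow> complex set" where
  "galois_conjugates x = {z. \<exists>p. is_min_poly p x \<and> poly (map_poly of_rat p) z = 0}"

definition alg_degree_le :: "complex \<Rightarrow> nat \<Rightarrow> bool" where
  "alg_degree_le x d \<longleftrightarrow> (\<exists>p. is_min_poly p x \<and> degree p \<le> d)"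

definition pisot :: "real \<Rightarrow> bool" where
  "pisot q \<longleftrightarrow> q > 1 \<and> algebraic_int q \<and>
     (\<forall>z \<in> galois_conjugates (complex_of_real q). z \<noteq> complex_of_real q \<longrightarrow> cmod z < 1)"

end

theory Submission
  imports Defs "HOL-Computational_Algebra.Field_as_Ring"
begin

text \<open>
  Suppose a conjugate \<open>z\<close> has modulus \<open>r < (\<surd>5 - 1) / 2\<close>. The constant term of the minimal
  polynomial is a nonzero integer of modulus \<open>q r R\<close>, where \<open>R \<le> 1\<close> is the product of the moduli of the
  remaining conjugates; as \<open>q r < 5/4\<close>, it is \<open>\<plusminus>1\<close>, so \<open>R = 1 / (q r)\<close> is close to \<open>1\<close>. Moreover \<open>z\<close> is
  real, since otherwise \<open>q r\<^sup>2 \<ge> 1\<close>. Because \<open>z\<close> is an algebraic unit, the sum \<open>N\<close> of \<open>x - 1/x\<close> over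
  all conjugates \<open>x\<close> is an integer, and the conjugates other than \<open>q\<close> and \<open>z\<close> contribute at most
  \<open>1/R - R = q r - 1 / (q r)\<close> to it in absolute value. These bounds squeeze \<open>N\<close> strictly between \<open>0\<close>
  and \<open>1\<close> if \<open>z > 0\<close>, and strictly between \<open>2\<close> and \<open>3\<close> if \<open>z < 0\<close>. The only exception is \<open>z = 1/q\<close>,
  where \<open>N = 0\<close>; there the trace \<open>q + 1/q\<close> fails to be an integer.
\<close>

section \<open>Minimal polynomials over the rationals: divisibility, integrality,
  separability\<close>

lemma map_poly_of_rat_mult:
  "map_poly of_rat (p * s) = map_poly of_rat p * (map_poly of_rat s :: 'a :: field_char_0 poly)"
  by (intro poly_eqI) (simp add: coeff_map_poly coeff_mult of_rat_sum of_rat_mult)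

lemma map_poly_of_rat_add:
  "map_poly of_rat (p + s) = map_poly of_rat p + (map_poly of_rat s :: 'a :: field_char_0 poly)"
  by (intro poly_eqI) (simp add: coeff_map_poly of_rat_add)

lemma map_poly_of_rat_pderiv:
  "map_poly of_rat (pderiv p) = (pderiv (map_poly of_rat p) :: 'a :: field_char_0 poly)"
  by (intro poly_eqI) (simp add: coeff_map_poly coeff_pderiv of_rat_mult of_rat_add)

text \<open>If \<open>p\<close> did not divide \<open>g\<close>, irreducibility would make them
  coprime, and a Bezout identity evaluated at \<open>x\<close> would read 0 = 1.\<close>

lemma is_min_poly_dvd:
  assumes "is_min_poly p x" and "poly (map_poly of_rat g) x = 0"
  shows "p dvd g"
proof (rule ccontr)
  assume nd: "\<not> p dvd g"
  have irr: "irreducible p" and px: "poly (map_poly of_rat p) x = 0"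
    using assms(1) by (auto simp: is_min_poly_def)
  have "coprime p g"
    using irr nd by (meson coprimeI irreducibleD' dvd_trans)
  then have "fst (bezout_coefficients p g) * p + snd (bezout_coefficients p g) * g = 1"
    by (simp only: bezout_coefficients_fst_snd coprime_iff_gcd_eq_1)
  then obtain a b where "a * p + b * g = 1"
    by blast
  then have "poly (map_poly of_rat (a * p + b * g)) x = poly (map_poly of_rat 1) x"
    by (rule arg_cong)
  then show False
    using px assms(2) by (simp add: map_poly_of_rat_add map_poly_of_rat_mult)
qed

lemma rat_poly_clear_denominators:
  fixes p :: "rat poly"
  obtains d :: int and P :: "int poly"
  where "d > 0" and "smult (of_int d) p = map_poly of_int P"
proof -
  have "\<exists>d P. d > 0 \<and> smult (of_int d) p = map_poly of_int P"
  proof (induction p)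
    case 0
    show ?case
      by (intro exI[of _ 1] exI[of _ 0]) simp
  next
    case (pCons a p)
    then obtain d P where dP: "d > 0" "smult (of_int d) p = map_poly of_int P"
      by blast
    obtain m n where mn: "n > 0" "a = of_int m / of_int n"
      by (metis quotient_of_denom_pos quotient_of_div surj_pair)
    have "smult (of_int (d * n)) (pCons a p) = map_poly of_int (pCons (d * m) (smult n P))"
    proof (rule poly_eqI)
      fix i
      have "of_int d * coeff p k = of_int (coeff P k)" for k
        using arg_cong[OF dP(2), of "\<lambda>f. coeff f k"] by (simp add: coeff_map_poly)
      then show "coeff (smult (of_int (d * n)) (pCons a p)) i =
          coeff (map_poly of_int (pCons (d * m) (smult n P))) i"
        using mn by (cases i) (simp_all add: coeff_map_poly field_simps)
    qed
    then show ?case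
      using dP(1) mn(1) by (metis mult_pos_pos)
  qed
  then show thesis
    using that by blast
qed

text \<open>Gauss's lemma. After clearing denominators,
  \<open>content P * content S = d * e\<close>, while each content divides its own denominator
  because both factors are monic. Hence the cofactors are units and \<open>d\<close> divides every
  coefficient of \<open>P\<close>.\<close>

lemma monic_rat_factor_of_monic_int_poly:
  fixes p :: "rat poly" and f :: "int poly"
  assumes "lead_coeff p = 1" and "lead_coeff f = 1" and "p dvd map_poly of_int f"
  shows "coeff p i \<in> \<int>"
proof -
  obtain s where s: "map_poly of_int f = p * s"
    using assms(3) by blast
  have "lead_coeff (map_poly of_int f :: rat poly) = 1"
    using assms(2) by (simp add: coeff_map_poly degree_map_poly)
  then have ls: "lead_coeff s = 1"
    using assms(1) by (simp add: s lead_coeff_mult)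
  obtain d P where P: "d > 0" "smult (of_int d) p = map_poly of_int P"
    by (rule rat_poly_clear_denominators)
  obtain e S where S: "e > 0" "smult (of_int e) s = map_poly of_int S"
    by (rule rat_poly_clear_denominators)
  have cP: "of_int (coeff P k) = of_int d * coeff p k" for k
    using arg_cong[OF P(2), of "\<lambda>f. coeff f k"] by (simp add: coeff_map_poly)
  have cS: "of_int (coeff S k) = of_int e * coeff s k" for k
    using arg_cong[OF S(2), of "\<lambda>f. coeff f k"] by (simp add: coeff_map_poly)
  have cf: "of_int (coeff f k) = coeff (p * s) k" for k
    using arg_cong[OF s, of "\<lambda>f. coeff f k"] by (simp add: coeff_map_poly)
  have PS: "P * S = smult (d * e) f"
  proof (rule poly_eqI)
    fix k
    have "(of_int (coeff (P * S) k) :: rat) = of_int (coeff (smult (d * e) f) k)"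
      by (simp add: coeff_mult cP cS cf sum_distrib_left mult_ac)
    then show "coeff (P * S) k = coeff (smult (d * e) f) k"
      by (simp only: of_int_eq_iff)
  qed
  have "content f dvd 1"
    using content_dvd_coeff[of f "degree f"] assms(2) by simp
  then have "content f = 1"
    by (metis is_unit_normalize normalize_content)
  then have eq: "content P * content S = d * e"
    using PS P(1) S(1) by (metis content_mult content_smult mult.right_neutral normalize_mult
        abs_of_pos normalize_int_def)
  have "(of_int (coeff P (degree p)) :: rat) = of_int d"
    using cP[of "degree p"] assms(1) by simp
  then have "content P dvd d"
    by (metis content_dvd_coeff of_int_eq_iff)
  then obtain u where u: "d = content P * u" by blast
  have "(of_int (coeff S (degree s)) :: rat) = of_int e"
    using cS[of "degree s"] ls by simp
  then have "content S dvd e"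
    by (metis content_dvd_coeff of_int_eq_iff)
  then obtain v where v: "e = content S * v" by blast
  have "content P * content S * (u * v) = content P * content S * 1"
    using eq u v by (simp add: mult_ac)
  then have "u * v = 1"
    using eq P(1) S(1) by (metis mult_cancel_left mult_eq_0_iff less_irrefl)
  then have "u dvd 1"
    by (metis dvd_triv_left)
  then have "d dvd content P"
    using u by (metis dvd_refl mult_unit_dvd_iff)
  then have "d dvd coeff P i"
    using content_dvd_coeff dvd_trans by blast
  then obtain k where "coeff P i = d * k" by blast
  then have "of_int d * coeff p i = of_int d * of_int k"
    using cP[of i] by (metis of_int_mult)
  then show ?thesis
    using P(1) by simp
qed

lemma is_min_poly_coeff_Ints:
  assumes "is_min_poly p x" and "algebraic_int x"
  shows "coeff p i \<in> \<int>"
proof -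
  obtain f where f: "poly (map_poly of_int f) x = 0" "lead_coeff f = 1"
    using assms(2) by (auto simp: algebraic_int_altdef_ipoly)
  have "map_poly of_rat (map_poly of_int f) = (map_poly of_int f :: complex poly)"
    by (simp add: map_poly_map_poly o_def)
  then have "p dvd map_poly of_int f"
    using is_min_poly_dvd[OF assms(1)] f(1) by metis
  then show ?thesis
    using monic_rat_factor_of_monic_int_poly assms(1) f(2) by (simp add: is_min_poly_def)
qed

text \<open>Otherwise \<open>p\<close> would also be the minimal polynomial of 0, hence divide the
  polynomial X, and \<open>x\<close> would be 0.\<close>

lemma is_min_poly_poly_0_nonzero:
  assumes "is_min_poly p x" and "x \<noteq> 0"
  shows "poly (map_poly of_rat p) (0 :: complex) \<noteq> 0"
proof
  assume "poly (map_poly of_rat p) (0 :: complex) = 0"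
  then have "is_min_poly p 0"
    using assms(1) by (simp add: is_min_poly_def)
  then have "p dvd [:0, 1:]"
    by (rule is_min_poly_dvd) (simp add: map_poly_pCons)
  then obtain s where s: "[:0, 1:] = p * s" by blast
  have "map_poly of_rat [:0, 1:] = map_poly of_rat p * (map_poly of_rat s :: complex poly)"
    unfolding s by (rule map_poly_of_rat_mult)
  then have "poly (map_poly of_rat [:0, 1:]) x = 0"
    using assms(1) by (simp add: is_min_poly_def)
  then show False
    using assms(2) by (simp add: map_poly_pCons)
qed

text \<open>Separability in characteristic 0: the derivative is nonzero of smaller degree, so
  \<open>p\<close> does not divide it and it cannot vanish at \<open>x\<close>. This ensures that
  the Pisot number occurs only once among the roots.\<close>

lemma is_min_poly_order:
  assumes "is_min_poly p x"
  shows "order x (map_poly of_rat p) = 1"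
proof -
  let ?p = "map_poly of_rat p :: complex poly"
  have lp: "lead_coeff p = 1" and irr: "irreducible p" and px: "poly ?p x = 0"
    using assms by (auto simp: is_min_poly_def)
  have p0: "?p \<noteq> 0"
    using lp by (auto simp: map_poly_eq_0_iff)
  have "degree p \<noteq> 0"
  proof
    assume "degree p = 0"
    then have "p = 1"
      using lp by (auto elim!: degree_eq_zeroE)
    then show False
      using irr by simp
  qed
  then have d0: "pderiv p \<noteq> 0"
    by (simp add: pderiv_eq_0_iff)
  have "\<not> p dvd pderiv p"
  proof
    assume "p dvd pderiv p"
    then have "degree p \<le> degree (pderiv p)"
      using d0 by (rule dvd_imp_degree_le)
    then show False
      using \<open>degree p \<noteq> 0\<close> by (simp add: degree_pderiv)
  qed
  then have "poly (pderiv ?p) x \<noteq> 0"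
    using is_min_poly_dvd[OF assms, of "pderiv p"] by (auto simp: map_poly_of_rat_pderiv)
  then have "order x (pderiv ?p) = 0"
    by (rule order_0I)
  then show ?thesis
    using order_pderiv[OF p0 px] by simp
qed

section \<open>Sums over the roots and over their inverses\<close>

lemma sum_mset_roots_Ints:
  fixes A :: "'a :: field multiset"
  assumes "\<And>i. coeff (\<Prod>x\<in>#A. [:-x, 1:]) i \<in> \<int>"
  shows "(\<Sum>x\<in>#A. x) \<in> \<int>"
proof -
  \<comment> \<open>Reversal moves the coefficient next to the leading one to index 1, so the
    induction needs no degree bookkeeping.\<close>
  have "coeff (reflect_poly (\<Prod>x\<in>#A. [:-x, 1:])) 0 = 1 \<and>
      coeff (reflect_poly (\<Prod>x\<in>#A. [:-x, 1:])) 1 = - (\<Sum>x\<in>#A. x)"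
  proof (induction A)
    case (add a A)
    have "reflect_poly [:-a, 1:] = [:1, -a:]"
      by (cases "a = 0") (simp_all add: reflect_poly_def)
    then have "reflect_poly (\<Prod>x\<in>#add_mset a A. [:-x, 1:]) =
        [:1, -a:] * reflect_poly (\<Prod>x\<in>#A. [:-x, 1:])"
      by (simp only: image_mset_add_mset prod_mset.add_mset reflect_poly_mult)
    with add show ?case
      by (simp only: coeff_mult) (simp add: coeff_pCons)
  qed simp
  moreover have "coeff (reflect_poly (\<Prod>x\<in>#A. [:-x, 1:])) 1 \<in> \<int>"
    using assms by (simp add: coeff_reflect_poly)
  ultimately show ?thesis
    by simp
qed

text \<open>This is the logarithmic derivative of the product, evaluated at 0.\<close>

lemma sum_mset_inverse_roots:
  fixes A :: "'a :: field multiset"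
  assumes "0 \<notin># A"
  shows "coeff (\<Prod>x\<in>#A. [:-x, 1:]) 1 = - coeff (\<Prod>x\<in>#A. [:-x, 1:]) 0 * (\<Sum>x\<in>#A. 1 / x)"
  using assms
proof (induction A)
  case (add a A)
  then have "a \<noteq> 0"
    by auto
  with add show ?case
    by (simp add: distrib_left algebra_simps)
qed simp

section \<open>Estimates for sums of \<open>x - 1/x\<close> in the unit disc\<close>

lemma abs_Re_diff_inverse_le:
  assumes "x \<noteq> 0" and "cmod x \<le> 1"
  shows "\<bar>Re (x - 1 / x)\<bar> \<le> 1 / cmod x - cmod x"
proof -
  have c: "cmod x > 0" "(cmod x)\<^sup>2 \<le> 1"
    using assms by (auto simp: power_le_one)
  have "Re (x - 1 / x) = - (Re x * (1 / (cmod x)\<^sup>2 - 1))"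
    by (simp add: Re_divide cmod_power2 algebra_simps)
  then have "\<bar>Re (x - 1 / x)\<bar> = \<bar>Re x\<bar> * (1 / (cmod x)\<^sup>2 - 1)"
    using c by (simp add: abs_mult)
  also have "\<dots> \<le> cmod x * (1 / (cmod x)\<^sup>2 - 1)"
    using c by (intro mult_right_mono abs_Re_le_cmod) simp
  also have "\<dots> = 1 / cmod x - cmod x"
    using c by (simp add: field_simps power2_eq_square)
  finally show ?thesis .
qed

text \<open>The gap factors as \<open>(1 - x) * (1 - y) * (1 / (x * y) - 1)\<close>. This lets a
  bound for single roots pass to the product of their moduli.\<close>

lemma inverse_diff_superadditive:
  fixes x y :: real
  assumes "0 < x" "x \<le> 1" "0 < y" "y \<le> 1"
  shows "(1 / x - x) + (1 / y - y) \<le> 1 / (x * y) - x * y"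
proof -
  have "1 / (x * y) - x * y - ((1 / x - x) + (1 / y - y)) = (1 - x) * (1 - y) * (1 / (x * y) - 1)"
    using assms by (simp add: field_simps)
  moreover have "x * y \<le> 1"
    using assms by (simp add: mult_le_one)
  then have "0 \<le> (1 - x) * (1 - y) * (1 / (x * y) - 1)"
    using assms by (intro mult_nonneg_nonneg) simp_all
  ultimately show ?thesis
    by linarith
qed

text \<open>
  For a conjugation-invariant multiset this is the Schwarz--Pick inequality at the origin for the
  Blaschke product with these zeros.
\<close>
lemma sum_mset_Re_diff_inverse_le:
  assumes "\<And>x. x \<in># A \<Longrightarrow> x \<noteq> 0 \<and> cmod x \<le> 1"
  shows "\<bar>\<Sum>x\<in>#A. Re (x - 1 / x)\<bar> \<le> 1 / (\<Prod>x\<in>#A. cmod x) - (\<Prod>x\<in>#A. cmod x) \<and>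
    0 < (\<Prod>x\<in>#A. cmod x) \<and> (\<Prod>x\<in>#A. cmod x) \<le> 1"
  using assms
proof (induction A)
  case (add a A)
  let ?P = "\<Prod>x\<in>#A. cmod x"
  have IH: "\<bar>\<Sum>x\<in>#A. Re (x - 1 / x)\<bar> \<le> 1 / ?P - ?P" "0 < ?P" "?P \<le> 1"
    using add by auto
  have a: "a \<noteq> 0" "cmod a \<le> 1"
    using add.prems by auto
  have "(1 / cmod a - cmod a) + (1 / ?P - ?P) \<le> 1 / (cmod a * ?P) - cmod a * ?P"
    using a IH by (intro inverse_diff_superadditive) auto
  moreover have "\<bar>Re (a - 1 / a)\<bar> \<le> 1 / cmod a - cmod a"
    using a by (rule abs_Re_diff_inverse_le)
  ultimately show ?case
    using IH a by (simp add: mult_le_one)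
qed simp

section \<open>Real inequalities that trap an integer\<close>

lemma no_int_between: "(x :: real) \<in> \<int> \<Longrightarrow> of_int k < x \<Longrightarrow> x < of_int k + 1 \<Longrightarrow> False"
  by (auto elim!: Ints_cases)

lemma golden_section:
  defines "g \<equiv> (sqrt 5 - 1) / 2"
  shows "g * g = 1 - g" and "g < 5 / 8"
proof -
  show "g * g = 1 - g"
    by (simp add: g_def field_simps)
  have "sqrt 5 < 9 / 4"
    by (rule real_less_lsqrt) (simp_all add: power2_eq_square)
  then show "g < 5 / 8"
    by (simp add: g_def)
qed

text \<open>\<open>E\<close> stands for the contribution of the conjugates other than
  \<open>q\<close> and \<open>r\<close>. At either extreme value of \<open>E\<close> the expression
  factors completely.\<close>

lemma positive_conjugate_bounds:
  fixes q r E :: real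
  assumes "1 < q" "q < 2" "0 < r" "r < (sqrt 5 - 1) / 2" "1 < q * r"
    and "\<bar>E\<bar> \<le> q * r - 1 / (q * r)"
  shows "0 < (q - 1 / q) - (1 / r - r) + E" and "(q - 1 / q) - (1 / r - r) + E < 1"
proof -
  have r: "r < 5 / 8"
    using assms(4) golden_section(2) by linarith
  have "(q - 1 / q) - (1 / r - r) - (q * r - 1 / (q * r)) = (q * r - 1) * (q - 1) * (1 - r) / (q * r)"
    using assms(1,3) by (simp add: field_simps)
  also have "\<dots> > 0"
    using assms r by (intro divide_pos_pos mult_pos_pos) auto
  finally show "0 < (q - 1 / q) - (1 / r - r) + E"
    using assms(6) by linarith
  \<comment> \<open>The difference vanishes at \<open>q = 2\<close>:
    \<open>(q * r - 1) * (q + 1) / q\<close> lies below its value there, which leaves a quadratic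
    inequality in \<open>r\<close> alone.\<close>
  have "3 * q * (2 * r - 1) - 2 * ((q * r - 1) * (q + 1)) = (2 - q) * (2 * (q * r) + 1)"
    by (simp add: algebra_simps)
  also have "\<dots> > 0"
    using assms by (intro mult_pos_pos) auto
  finally have "2 * ((q * r - 1) * (q + 1)) * (1 + r) < 3 * q * (2 * r - 1) * (1 + r)"
    using assms(3) by (intro mult_strict_right_mono) auto
  also have "\<dots> = q * (3 * ((2 * r - 1) * (1 + r)))"
    by (simp add: algebra_simps)
  also have "\<dots> \<le> q * (2 * r)"
  proof (intro mult_left_mono)
    have "r * r \<le> 5 / 8 * r"
      using r assms(3) by (intro mult_right_mono) auto
    then show "3 * ((2 * r - 1) * (1 + r)) \<le> 2 * r"
      using r by (simp add: algebra_simps)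
  qed (use assms in auto)
  finally have "(q * r - 1) * (q + 1) * (1 + r) / (q * r) < 1"
    using assms by (simp add: field_simps)
  moreover have "(q - 1 / q) - (1 / r - r) + (q * r - 1 / (q * r)) =
      (q * r - 1) * (q + 1) * (1 + r) / (q * r)"
    using assms(1,3) by (simp add: field_simps)
  ultimately show "(q - 1 / q) - (1 / r - r) + E < 1"
    using assms(6) by linarith
qed

text \<open>Here the conjugate is \<open>-r\<close>, which flips the sign of
  \<open>1 / r - r\<close>. The extremes of \<open>E\<close> again give complete
  factorizations.\<close>

lemma negative_conjugate_bounds:
  fixes q r E :: real
  assumes "1 < q" "q < 2" "0 < r" "r < (sqrt 5 - 1) / 2" "1 \<le> q * r"
    and "\<bar>E\<bar> \<le> q * r - 1 / (q * r)"
  shows "2 < (q - 1 / q) + (1 / r - r) + E" and "(q - 1 / q) + (1 / r - r) + E < 3"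
proof -
  define g :: real where "g = (sqrt 5 - 1) / 2"
  have g: "g * g = 1 - g" "g < 5 / 8" "r < g"
    using golden_section assms(4) by (simp_all add: g_def)
  have "r * r < g * g"
    using g assms(3) by (intro mult_strict_mono) auto
  then have rr: "r * r < 1 - r"
    using g by linarith
  define t where "t = q * r - 1"
  have t: "t \<ge> 0"
    using assms(5) by (simp add: t_def)
  have q: "q = (1 + t) / r"
    using assms(3) by (simp add: t_def)
  have "r * r \<le> 5 / 8 * r"
    using g assms(3) by (intro mult_right_mono) auto
  then have "0 \<le> 3 - 4 * r - r * r"
    using g by linarith
  \<comment> \<open>An expansion in the excess \<open>t\<close> of \<open>q * r\<close> over 1. Its
    constant term is positive exactly because \<open>r\<close> is below the golden section;
    elsewhere the bound 5/8 suffices.\<close>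
  then have "0 < 2 * (1 - r - r * r) + t * (3 - 4 * r - r * r) + (1 - r) * (t * t)"
    using rr t g by (intro add_pos_nonneg mult_nonneg_nonneg) auto
  also have "\<dots> = r * ((1 - r) * (q + 1) * (1 + q * r) - 2 * (q * r))"
    using assms(3) by (simp add: q field_simps)
  finally have "2 * (q * r) < (1 - r) * (q + 1) * (1 + q * r)"
    using assms(3) by (simp add: zero_less_mult_iff)
  then have "2 < (1 - r) * (q + 1) * (1 + q * r) / (q * r)"
    using assms(1,3) by (simp add: pos_less_divide_eq)
  moreover have "(q - 1 / q) + (1 / r - r) - (q * r - 1 / (q * r)) =
      (1 - r) * (q + 1) * (1 + q * r) / (q * r)"
    using assms(1,3) by (simp add: field_simps)
  ultimately show "2 < (q - 1 / q) + (1 / r - r) + E"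
    using assms(6) by linarith
  have "q * r < 2 * r"
    using assms by (intro mult_strict_right_mono) auto
  then have r: "1 / 2 \<le> r"
    using assms(5) by linarith
  \<comment> \<open>Comparison with \<open>q = 2\<close> again; the remaining quadratic in
    \<open>r\<close> has roots 1/2 and 1, whence the need for \<open>1 / 2 \<le> r\<close>.\<close>
  have "q * (1 + 2 * r) - 2 * ((q - 1) * (1 + q * r)) = (2 - q) * (1 + 2 * (q * r))"
    by (simp add: algebra_simps)
  also have "\<dots> > 0"
    using assms by (intro mult_pos_pos) auto
  finally have "2 * ((q - 1) * (1 + q * r)) * (1 + r) < q * (1 + 2 * r) * (1 + r)"
    using assms(3) by (intro mult_strict_right_mono) auto
  also have "\<dots> = q * ((1 + 2 * r) * (1 + r))"
    by simp
  also have "\<dots> \<le> q * (6 * r)"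
  proof (intro mult_left_mono)
    have "0 \<le> (2 * r - 1) * (1 - r)"
      using r g by (intro mult_nonneg_nonneg) auto
    then show "(1 + 2 * r) * (1 + r) \<le> 6 * r"
      by (simp add: algebra_simps)
  qed (use assms in auto)
  finally have "(1 + r) * (q - 1) * (1 + q * r) < 3 * (q * r)"
    by (simp add: algebra_simps)
  then have "(1 + r) * (q - 1) * (1 + q * r) / (q * r) < 3"
    using assms(1,3) by (simp add: pos_divide_less_eq)
  moreover have "(q - 1 / q) + (1 / r - r) + (q * r - 1 / (q * r)) =
      (1 + r) * (q - 1) * (1 + q * r) / (q * r)"
    using assms(1,3) by (simp add: field_simps)
  ultimately show "(q - 1 / q) + (1 / r - r) + E < 3"
    using assms(6) by linarith
qed

section \<open>The integer attached to a small conjugate, and the contradiction\<close>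

lemma Re_sum_mset: "Re (\<Sum>x\<in>#A. f x) = (\<Sum>x\<in>#A. Re (f x))"
  by (induction A) auto

lemma norm_prod_mset: "cmod (\<Prod>x\<in>#A. f x) = (\<Prod>x\<in>#A. cmod (f x))"
  by (induction A) (auto simp: norm_mult)

lemma Ints_Re: "x \<in> \<int> \<Longrightarrow> Re x \<in> \<int>"
  by (auto elim!: Ints_cases)

lemma pisot_conjugate_cmod_ge:
  fixes q :: real
  assumes "pisot q" and "1 < q" and "q < 2" and "z \<in> galois_conjugates (complex_of_real q)"
  shows "(sqrt 5 - 1) / 2 \<le> cmod z"
proof (rule ccontr)
  define r where "r = cmod z"
  assume "\<not> (sqrt 5 - 1) / 2 \<le> cmod z"
  then have rg: "r < (sqrt 5 - 1) / 2"
    by (simp add: r_def)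
  then have r58: "r < 5 / 8"
    using golden_section(2) by linarith
  obtain p where p: "is_min_poly p (of_real q)" and pz: "poly (map_poly of_rat p) z = 0"
    using assms(4) by (auto simp: galois_conjugates_def)
  define P where "P = (map_poly of_rat p :: complex poly)"
  have "algebraic_int (complex_of_real q)"
    using assms(1) by (simp add: pisot_def)
  then have "coeff p i \<in> \<int>" for i
    by (rule is_min_poly_coeff_Ints[OF p])
  then have PI: "coeff P i \<in> \<int>" for i
    by (simp add: P_def coeff_map_poly) (metis Ints_of_int of_rat_of_int_eq Ints_cases)
  have lP: "lead_coeff P = 1"
    using p by (simp add: P_def is_min_poly_def coeff_map_poly degree_map_poly)
  then have P0: "P \<noteq> 0"
    by auto
  have rootq: "poly P (of_real q) = 0"
    using p by (simp add: P_def is_min_poly_def)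
  define M where "M = proots P"
  have PM: "P = (\<Prod>x\<in>#M. [:-x, 1:])"
    using complex_poly_decompose_multiset[of P] lP by (simp add: M_def)
  have inM: "x \<in># M \<longleftrightarrow> poly P x = 0" for x
    using P0 by (simp add: M_def)
  have nz: "poly P 0 \<noteq> 0"
    unfolding P_def using p assms(2) by (intro is_min_poly_poly_0_nonzero[of p "of_real q"]) auto
  have "order (of_real q) P = 1"
    unfolding P_def using p by (rule is_min_poly_order)
  then have countq: "count M (of_real q) = 1"
    using P0 by (simp add: M_def)
  \<comment> \<open>As \<open>q\<close> is a simple root, removing it once leaves only roots to
    which the Pisot condition applies.\<close>
  define A where "A = M - {#of_real q#}"
  have MA: "M = add_mset (of_real q) A"
    using rootq inM by (simp add: A_def)
  have qA: "of_real q \<notin># A"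
    using countq by (simp add: MA count_eq_zero_iff)
  have small: "x \<noteq> 0 \<and> cmod x < 1" if "x \<in># A" for x
  proof -
    have "x \<in># M" "x \<noteq> of_real q"
      using that qA by (auto simp: MA)
    moreover from this have "x \<in> galois_conjugates (of_real q)"
      using p inM by (auto simp: galois_conjugates_def P_def)
    ultimately show ?thesis
      using assms(1) nz inM by (auto simp: pisot_def)
  qed
  have "z \<noteq> of_real q"
    using r58 assms(2) by (auto simp: r_def)
  then have zA: "z \<in># A"
    using pz inM by (auto simp: MA P_def)
  define B where "B = A - {#z#}"
  have AB: "A = add_mset z B"
    using zA by (simp add: B_def)
  have smallB: "x \<noteq> 0 \<and> cmod x \<le> 1" if "x \<in># B" for x
    using small[of x] that by (auto simp: AB)
  have r0: "r > 0"
    using small[OF zA] by (simp add: r_def)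
  define R where "R = (\<Prod>x\<in>#B. cmod x)"
  have R: "\<bar>\<Sum>x\<in>#B. Re (x - 1 / x)\<bar> \<le> 1 / R - R" "0 < R" "R \<le> 1"
    using sum_mset_Re_diff_inverse_le[of B] smallB by (auto simp: R_def)
  have "coeff P 0 = poly P 0"
    by (simp add: poly_0_coeff_0)
  also have "\<dots> = (\<Prod>x\<in>#M. -x)"
    unfolding PM by (induction M) auto
  finally have c0: "cmod (coeff P 0) = q * r * R"
    using assms(2) by (simp add: norm_prod_mset norm_mult MA AB r_def R_def)
  obtain c where c: "coeff P 0 = of_int c"
    using PI by (auto elim: Ints_cases)
  then have "real_of_int \<bar>c\<bar> = q * r * R"
    using c0 by simp
  moreover have "c \<noteq> 0"
    using c nz by (auto simp: poly_0_coeff_0)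
  ultimately have qrR1: "1 \<le> q * r * R"
    by (metis of_int_1_le_iff zero_less_abs_iff int_one_le_iff_zero_less)
  have qr2: "q * r < 2 * (5 / 8)"
    using assms r0 r58 by (intro mult_strict_mono) auto
  moreover have "q * r * R \<le> q * r"
    using R assms(2) r0 by (intro mult_left_le) auto
  ultimately have qrR: "q * r * R < 5 / 4"
    by linarith
  have "real_of_int \<bar>c\<bar> < 2"
    using \<open>real_of_int \<bar>c\<bar> = q * r * R\<close> qrR by linarith
  then have c1: "\<bar>c\<bar> = 1"
    using \<open>c \<noteq> 0\<close> by linarith
  then have "q * r * R = 1"
    using \<open>real_of_int \<bar>c\<bar> = q * r * R\<close> by simp
  then have Req: "R = 1 / (q * r)"
    using assms(2) r0 by (simp add: field_simps)
  have qr1: "1 \<le> q * r"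
    using qrR1 \<open>q * r * R \<le> q * r\<close> by linarith
  have real: "z = of_real (Re z)"
  proof (rule ccontr)
    assume "z \<noteq> of_real (Re z)"
    then have cz: "cnj z \<noteq> z"
      by (auto simp: complex_eq_iff)
    have "map_poly cnj P = P"
      by (intro poly_eqI) (simp add: coeff_map_poly, metis PI Ints_cases complex_cnj_of_int)
    then have "poly P (cnj z) = 0"
      using pz by (metis P_def complex_cnj_zero complex_cnj_cnj poly_map_poly_cnj)
    moreover have "cnj z \<noteq> of_real q"
      using \<open>z \<noteq> of_real q\<close> by (metis complex_cnj_cnj complex_cnj_complex_of_real)
    ultimately have "cnj z \<in># B"
      using inM cz by (auto simp: MA AB)
    then obtain C where C: "B = add_mset (cnj z) C"
      by (metis multi_member_split)
    have "(\<Prod>x\<in>#C. cmod x) \<le> 1"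
      using sum_mset_Re_diff_inverse_le[of C] smallB by (auto simp: C)
    \<comment> \<open>\<open>cnj z\<close> contributes a factor \<open>r\<close> to
      \<open>R\<close>, and the other factors are at most 1.\<close>
    then have "R \<le> r"
      using r0 by (simp add: R_def C r_def mult_left_le)
    then have "1 \<le> q * r * r"
      using qrR1 assms(2) r0 by (smt (verit) mult_left_mono mult_pos_pos)
    moreover have "q * r * r \<le> 5 / 4 * r"
      using qr2 r0 by (intro mult_right_mono) auto
    ultimately show False
      using r58 by linarith
  qed
  have "0 \<notin># M"
    using nz inM by simp
  then have "coeff P 1 = - coeff P 0 * (\<Sum>x\<in>#M. 1 / x)"
    unfolding PM by (rule sum_mset_inverse_roots)
  \<comment> \<open>The constant term is its own inverse, so dividing by it preserves
    integrality.\<close>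
  moreover have "of_int c * of_int c = (1 :: complex)"
    using c1 by (metis abs_mult_self_eq mult.right_neutral of_int_1 of_int_mult)
  ultimately have "(\<Sum>x\<in>#M. 1 / x) = - coeff P 0 * coeff P 1"
    by (simp add: c flip: mult.assoc)
  then have inv_int: "(\<Sum>x\<in>#M. 1 / x) \<in> \<int>"
    using PI by simp
  have sum_int: "(\<Sum>x\<in>#M. x) \<in> \<int>"
    by (rule sum_mset_roots_Ints) (use PI in \<open>simp add: PM [symmetric]\<close>)
  define E where "E = (\<Sum>x\<in>#B. Re (x - 1 / x))"
  have E: "\<bar>E\<bar> \<le> q * r - 1 / (q * r)"
    using R(1) by (simp add: E_def Req)
  have "Re ((\<Sum>x\<in>#M. x) - (\<Sum>x\<in>#M. 1 / x)) \<in> \<int>"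
    using inv_int sum_int by (intro Ints_Re Ints_diff)
  also have "(\<Sum>x\<in>#M. x) - (\<Sum>x\<in>#M. 1 / x) = (\<Sum>x\<in>#M. x - 1 / x)"
    by (induction M) simp_all
  also have "Re \<dots> = (q - 1 / q) + (Re z - Re (1 / z)) + E"
    by (simp add: MA AB E_def Re_sum_mset)
  finally have N: "(q - 1 / q) + (Re z - Re (1 / z)) + E \<in> \<int>" .
  have Rez: "Re (1 / z) = 1 / Re z"
    using Re_divide_of_real[of 1 "Re z"] by (simp flip: real)
  have "\<bar>Re z\<bar> = r"
    using real by (metis norm_of_real r_def)
  then consider "Re z = r" | "Re z = - r"
    by linarith
  then show False
  proof cases
    case 1
    show False
    proof (cases "B = {#}")
      case True
      have "q + r \<in> \<int>"
        using Ints_Re[OF sum_int] by (simp add: MA AB True 1)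
      moreover have "q * r = 1"
        using Req assms(2) r0 by (simp add: R_def True)
      \<comment> \<open>With \<open>q * r = 1\<close> the difference of the two sides is the square
        of \<open>q - 1\<close>.\<close>
      then have "q * 2 < q * (q + r)"
        using assms(2) mult_pos_pos[of "q - 1" "q - 1"] by (simp add: algebra_simps)
      then have "2 < q + r"
        using assms(2) by (simp only: mult_less_cancel_left_pos)
      moreover have "q + r < 3"
        using assms(3) r58 by linarith
      ultimately show False
        using no_int_between[of "q + r" 2] by simp
    next
      \<comment> \<open>A further conjugate has modulus strictly below 1, which makes
        \<open>1 < q * r\<close> strict, as the lower bound in the positive case requires.\<close>
      case False
      then obtain b C where C: "B = add_mset b C"
        by (meson multiset_cases)
      have "(\<Prod>x\<in>#C. cmod x) \<le> 1"
        using sum_mset_Re_diff_inverse_le[of C] smallB by (auto simp: C)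
      then have "R \<le> cmod b"
        by (simp add: R_def C mult_left_le)
      also have "\<dots> < 1"
        using small[of b] by (simp add: AB C)
      finally have "1 < q * r"
        using assms(2) r0 by (simp add: Req)
      moreover have "(q - 1 / q) - (1 / r - r) + E \<in> \<int>"
        using N by (simp add: Rez 1 algebra_simps)
      ultimately show False
        using positive_conjugate_bounds[OF assms(2,3) r0 rg _ E] no_int_between[of _ 0] by simp
    qed
  next
    case 2
    have "(q - 1 / q) + (1 / r - r) + E \<in> \<int>"
      using N by (simp add: Rez 2 algebra_simps)
    then show False
      using negative_conjugate_bounds[OF assms(2,3) r0 rg qr1 E] no_int_between[of _ 2] by simp
  qed
qed

theorem theorem5p2:
  fixes q :: real
  assumes "pisot q" and "1 < q" and "q < 2"
    and "alg_degree_le (complex_of_real q) 150"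
  shows "\<forall>z \<in> galois_conjugates (complex_of_real q). cmod z \<ge> (sqrt 5 - 1) / 2"
  using pisot_conjugate_cmod_ge[OF assms(1-3)] by blast

end
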